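(* Let $\widetilde{\mathcal{S}}$ be the set of similarity classes of triangles, $\mathcal{D}=\{z\in\mathbb{C}:|z|<1\}$, $\rho=e^{\pi i/3}$, $A_0=i$, $B_0=-e^{\pi i/6}$, $C_0=e^{-\pi i/6}$. Let $\phi:\widetilde{\mathcal{S}}\to\mathcal{D}$ be the bijection given by $$\phi([\triangle ABC])=\frac{A+\rho^2B+\rho^{4}C}{A+\rho^{4}B+\rho^{2}C},$$ and let $\phi_P:\widetilde{\mathcal{S}}\to\mathcal{D}$ be the bijection whose inverse is given by $$\phi_P^{-1}(P)=[\triangle(|P-A_0|,|P-B_0|,|P-C_0|)]\qquad(P\in\mathcal{D}).$$ Then $\phi\circ\phi_P^{-1}(z)=i\bar z$ for all $z\in\mathcal{D}$.
   Context: The plane $\mathbb{R}^2$ is identified with $\mathbb{C}$. Triangles are non-degenerate, with ordered vertices $A,B,C\in\mathbb{C}$ labeled anti-clockwise. Two triangles are similar if a composition of homothety, rotation and translation maps one to the other, respecting the order of vertices; $[\triangle ABC]$ is the similarity class. For $a,b,c>0$ satisfying the three strict triangle inequalities, $\triangle(a,b,c)$ denotes any triangle $\triangle ABC$ with $|B-C|=a$, $|C-A|=b$, $|A-B|=c$ (well defined up to similarity). For every $P\in\mathcal{D}$ the numbers $|P-A_0|,|P-B_0|,|P-C_0|$ are side lengths of a triangle (Pompeiu's theorem). *)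

theory Defs
  imports "HOL-Analysis.Analysis"
begin

section \<open>Triangles and similarity classes\<close>

type_synonym vertices = "complex \<times> complex \<times> complex"

text \<open>Anti-clockwise means that \<open>C\<close> lies strictly to the left of the directed line from
  \<open>A\<close> to \<open>B\<close>: the signed area \<open>Im ((C - A) * cnj (B - A)) / 2\<close> is positive.\<close>

definition anticlockwise :: "complex \<Rightarrow> complex \<Rightarrow> complex \<Rightarrow> bool" where
  "anticlockwise A B C \<longleftrightarrow> Im ((C - A) * cnj (B - A)) > 0"

definition triangles :: "vertices set" where
  "triangles = {(A, B, C). \<not> collinear {A, B, C} \<and> anticlockwise A B C}"

definition homothety :: "complex \<Rightarrow> real \<Rightarrow> complex \<Rightarrow> complex" where
  "homothety c k z = c + of_real k * (z - c)"

definition rotation :: "complex \<Rightarrow> real \<Rightarrow> complex \<Rightarrow> complex" where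
  "rotation c \<theta> z = c + cis \<theta> * (z - c)"

definition translation :: "complex \<Rightarrow> complex \<Rightarrow> complex" where
  "translation t z = z + t"

definition direct_similarity :: "(complex \<Rightarrow> complex) \<Rightarrow> bool" where
  "direct_similarity f \<longleftrightarrow>
     (\<exists>c k d \<theta> t. k \<noteq> 0 \<and> f = translation t \<circ> rotation d \<theta> \<circ> homothety c k)"

definition similarity :: "(vertices \<times> vertices) set" where
  "similarity = {((A, B, C), (A', B', C')).
     (A, B, C) \<in> triangles \<and> (A', B', C') \<in> triangles \<and>
     (\<exists>f. direct_similarity f \<and> f A = A' \<and> f B = B' \<and> f C = C')}"

definition sim_class :: "vertices \<Rightarrow> vertices set" where
  "sim_class T = similarity `` {T}"

definition sim_classes :: "vertices set set" where
  "sim_classes = triangles // similarity"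

lemma direct_similarity_iff:
  "direct_similarity f \<longleftrightarrow> (\<exists>a b. a \<noteq> 0 \<and> f = (\<lambda>z. a * z + b))"
proof
  assume "direct_similarity f"
  then obtain c k d \<theta> t where k: "k \<noteq> 0"
    and f: "f = translation t \<circ> rotation d \<theta> \<circ> homothety c k"
    unfolding direct_similarity_def by blast
  let ?a = "cis \<theta> * of_real k"
  have "f = (\<lambda>z. ?a * z + (d + cis \<theta> * (c - of_real k * c - d) + t))"
    by (rule ext) (simp add: f translation_def rotation_def homothety_def algebra_simps)
  moreover have "?a \<noteq> 0" using k by simp
  ultimately show "\<exists>a b. a \<noteq> 0 \<and> f = (\<lambda>z. a * z + b)" by blast
next
  assume "\<exists>a b. a \<noteq> 0 \<and> f = (\<lambda>z. a * z + b)"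
  then obtain a b where a: "a \<noteq> 0" and f: "f = (\<lambda>z. a * z + b)" by blast
  have "a = cis (Arg a) * of_real (cmod a)"
    using rcis_cmod_Arg[of a] by (simp add: rcis_def mult.commute)
  then have "f = translation b \<circ> rotation 0 (Arg a) \<circ> homothety 0 (cmod a)"
    by (intro ext) (simp add: f translation_def rotation_def homothety_def flip: mult.assoc)
  then show "direct_similarity f"
    unfolding direct_similarity_def using a by (metis norm_eq_zero)
qed

lemma similarity_iff:
  "((A, B, C), (A', B', C')) \<in> similarity \<longleftrightarrow>
     (A, B, C) \<in> triangles \<and> (A', B', C') \<in> triangles \<and>
     (\<exists>a b. a \<noteq> 0 \<and> A' = a * A + b \<and> B' = a * B + b \<and> C' = a * C + b)"
  unfolding similarity_def direct_similarity_iff by auto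

lemma equiv_similarity: "equiv triangles similarity"
proof (rule equivI)
  show "similarity \<subseteq> triangles \<times> triangles"
    by (auto simp: similarity_def)
  show "refl_on triangles similarity"
    by (rule refl_onI) (force simp: similarity_iff intro: exI[of _ 1] exI[of _ 0])
  show "sym similarity"
  proof (rule symI)
    fix S T assume "(S, T) \<in> similarity"
    moreover obtain A B C A' B' C' where S: "S = (A, B, C)" and T: "T = (A', B', C')"
      by (metis prod_cases3)
    ultimately obtain a b where "a \<noteq> 0"
      "A' = a * A + b" "B' = a * B + b" "C' = a * C + b" "S \<in> triangles" "T \<in> triangles"
      by (auto simp: similarity_iff)
    moreover from this have "A = (1 / a) * A' + (- b / a)" "B = (1 / a) * B' + (- b / a)"
      "C = (1 / a) * C' + (- b / a)" "1 / a \<noteq> 0"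
      by (simp_all add: field_simps)
    ultimately show "(T, S) \<in> similarity"
      unfolding S T similarity_iff by blast
  qed
  show "trans similarity"
  proof (rule transI)
    fix S T U assume "(S, T) \<in> similarity" "(T, U) \<in> similarity"
    moreover obtain A B C A' B' C' A'' B'' C'' where
      S: "S = (A, B, C)" and T: "T = (A', B', C')" and U: "U = (A'', B'', C'')"
      by (metis prod_cases3)
    ultimately obtain a b c d where "a \<noteq> 0" "c \<noteq> 0"
      "A' = a * A + b" "B' = a * B + b" "C' = a * C + b"
      "A'' = c * A' + d" "B'' = c * B' + d" "C'' = c * C' + d"
      "S \<in> triangles" "U \<in> triangles"
      by (auto simp: similarity_iff)
    moreover from this have "A'' = (c * a) * A + (c * b + d)" "B'' = (c * a) * B + (c * b + d)"
      "C'' = (c * a) * C + (c * b + d)" "c * a \<noteq> 0"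
      by (simp_all add: algebra_simps)
    ultimately show "(S, U) \<in> similarity"
      unfolding S U similarity_iff by blast
  qed
qed


section \<open>The map \<open>phi\<close>\<close>

definition unit_disk :: "complex set" where
  "unit_disk = {z. cmod z < 1}"

definition rho :: complex where
  "rho = exp (of_real pi * \<i> / 3)"

definition vertex_quotient :: "vertices \<Rightarrow> complex" where
  "vertex_quotient = (\<lambda>(A, B, C).
     (A + rho ^ 2 * B + rho ^ 4 * C) / (A + rho ^ 4 * B + rho ^ 2 * C))"

text \<open>\<open>vertex_quotient\<close> is constant on every similarity class, see \<open>phi_sim_class\<close>.\<close>

definition phi :: "vertices set \<Rightarrow> complex" where
  "phi X = the_elem (vertex_quotient ` X)"

lemma rho_sum: "1 + rho ^ 2 + rho ^ 4 = 0"
proof -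
  have "rho ^ 3 = exp (of_real pi * \<i>)"
    unfolding rho_def by (simp flip: exp_of_nat_mult)
  then have r3: "rho ^ 3 = -1" by (simp add: exp_pi_i)
  have "rho \<noteq> -1"
  proof
    assume "rho = -1"
    moreover have "Re rho = 1 / 2" by (simp add: rho_def Re_exp cos_60)
    ultimately have "Re (-1) = 1 / 2" by metis
    then show False by simp
  qed
  moreover have "(rho + 1) * (rho ^ 2 - rho + 1) = 0"
    using r3 by (simp add: algebra_simps power2_eq_square power3_eq_cube)
  ultimately have "rho ^ 2 - rho + 1 = 0"
    by (metis add_eq_0_iff2 mult_eq_0_iff)
  moreover have "rho ^ 4 = - rho"
    using r3 by (simp add: power4_eq_xxxx power3_eq_cube)
  ultimately show ?thesis by (simp add: algebra_simps)
qed

lemma vertex_quotient_cong: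
  assumes "(S, T) \<in> similarity"
  shows "vertex_quotient S = vertex_quotient T"
proof -
  obtain A B C A' B' C' where S: "S = (A, B, C)" and T: "T = (A', B', C')"
    by (metis prod_cases3)
  with assms obtain a b where "a \<noteq> 0"
    and eq: "A' = a * A + b" "B' = a * B + b" "C' = a * C + b"
    by (auto simp: similarity_iff)
  have "A' + rho ^ 2 * B' + rho ^ 4 * C'
      = a * (A + rho ^ 2 * B + rho ^ 4 * C) + b * (1 + rho ^ 2 + rho ^ 4)"
    and "A' + rho ^ 4 * B' + rho ^ 2 * C'
      = a * (A + rho ^ 4 * B + rho ^ 2 * C) + b * (1 + rho ^ 2 + rho ^ 4)"
    unfolding eq by (simp_all add: algebra_simps)
  then show ?thesis
    using \<open>a \<noteq> 0\<close> by (simp add: S T vertex_quotient_def rho_sum)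
qed

lemma phi_sim_class:
  assumes "(A, B, C) \<in> triangles"
  shows "phi (sim_class (A, B, C)) =
    (A + rho ^ 2 * B + rho ^ 4 * C) / (A + rho ^ 4 * B + rho ^ 2 * C)"
proof -
  have "(A, B, C) \<in> sim_class (A, B, C)"
    using assms equiv_class_self[OF equiv_similarity] by (simp add: sim_class_def)
  moreover have "vertex_quotient T = vertex_quotient (A, B, C)"
    if "T \<in> sim_class (A, B, C)" for T
    using that vertex_quotient_cong[of "(A, B, C)" T] by (simp add: sim_class_def)
  ultimately have "vertex_quotient ` sim_class (A, B, C) = {vertex_quotient (A, B, C)}"
    by blast
  then show ?thesis by (simp add: phi_def vertex_quotient_def)
qed


section \<open>Triangles with prescribed sides and the map \<open>phi_P\<close>\<close>

definition has_sides :: "real \<Rightarrow> real \<Rightarrow> real \<Rightarrow> vertices \<Rightarrow> bool" where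
  "has_sides a b c = (\<lambda>(A, B, C). cmod (B - C) = a \<and> cmod (C - A) = b \<and> cmod (A - B) = c)"

text \<open>The choice is possible and irrelevant up to similarity when \<open>a, b, c\<close> satisfy the strict
  triangle inequalities, see \<open>triangle_with_sides_exists\<close> and \<open>same_sides_similar\<close>.\<close>

definition triangle_with_sides :: "real \<Rightarrow> real \<Rightarrow> real \<Rightarrow> vertices" where
  "triangle_with_sides a b c = (SOME T. T \<in> triangles \<and> has_sides a b c T)"

definition A0 :: complex where "A0 = \<i>"
definition B0 :: complex where "B0 = - exp (of_real pi * \<i> / 6)"
definition C0 :: complex where "C0 = exp (- of_real pi * \<i> / 6)"

definition pompeiu_class :: "complex \<Rightarrow> vertices set" where
  "pompeiu_class P = sim_class (triangle_with_sides (cmod (P - A0)) (cmod (P - B0)) (cmod (P - C0)))"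

definition phi_P :: "vertices set \<Rightarrow> complex" where
  "phi_P = the_inv_into unit_disk pompeiu_class"

lemma anticlockwise_imp_not_collinear:
  assumes "anticlockwise A B C"
  shows "\<not> collinear {A, B, C}"
proof
  assume "collinear {A, B, C}"
  then have "collinear {B, A, C}" by (simp add: insert_commute)
  then have "collinear {0, B - A, C - A}" by (simp add: collinear_3)
  then obtain r where "B - A = 0 \<or> C - A = 0 \<or> C - A = r *\<^sub>R (B - A)"
    by (auto simp: collinear_lemma)
  moreover have "Im ((of_real r * w) * cnj w) = 0" for r :: real and w
    by (simp add: algebra_simps)
  ultimately have "Im ((C - A) * cnj (B - A)) = 0"
    by (metis complex_cnj_zero mult_zero_left mult_zero_right scaleR_conv_of_real zero_complex.simps(2))
  then show False using assms by (simp add: anticlockwise_def)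
qed

lemma triangle_with_sides_exists:
  fixes a b c :: real
  assumes "a > 0" "b > 0" "c > 0" "a < b + c" "b < c + a" "c < a + b"
  shows "\<exists>T \<in> triangles. has_sides a b c T"
proof -
  define x where "x = (b\<^sup>2 + c\<^sup>2 - a\<^sup>2) / (2 * c)"
  define y where "y = sqrt (b\<^sup>2 - x\<^sup>2)"
  have "(b - c)\<^sup>2 < a\<^sup>2" "a\<^sup>2 < (b + c)\<^sup>2"
    using assms by (auto simp: abs_less_iff intro!: power2_strict_mono)
  then have "\<bar>x\<bar> < b"
    using assms by (auto simp: x_def abs_less_iff field_simps power2_eq_square)
  then have "x\<^sup>2 < b\<^sup>2" using assms by (simp add: power2_strict_mono)
  then have y: "y > 0" "y\<^sup>2 = b\<^sup>2 - x\<^sup>2" by (simp_all add: y_def)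
  have x: "2 * c * x = b\<^sup>2 + c\<^sup>2 - a\<^sup>2" using assms by (simp add: x_def)
  have "(c - x)\<^sup>2 + y\<^sup>2 = a\<^sup>2"
    using x y(2) by (simp add: power2_eq_square algebra_simps)
  then have "cmod (of_real c - Complex x y) = a"
    using assms by (simp add: cmod_def)
  moreover have "cmod (Complex x y) = b" using y(2) assms by (simp add: cmod_def)
  ultimately have "has_sides a b c (0, of_real c, Complex x y)"
    using assms by (simp add: has_sides_def)
  moreover have "anticlockwise 0 (of_real c) (Complex x y)"
    using y(1) assms by (simp add: anticlockwise_def)
  ultimately show ?thesis
    using anticlockwise_imp_not_collinear unfolding triangles_def by blast
qed

lemma same_sides_similar:
  assumes "S \<in> triangles" "T \<in> triangles" "has_sides a b c S" "has_sides a b c T"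
  shows "(S, T) \<in> similarity"
proof -
  obtain A B C A' B' C' where S: "S = (A, B, C)" and T: "T = (A', B', C')"
    by (metis prod_cases3)
  define u v u' v' where "u = B - A" and "v = C - A" and "u' = B' - A'" and "v' = C' - A'"
  note defs = u_def v_def u'_def v'_def
  define p p' where "p = v * cnj u" and "p' = v' * cnj u'"
  have sides: "cmod u = c" "cmod v = b" "cmod (v - u) = a"
    "cmod u' = c" "cmod v' = b" "cmod (v' - u') = a"
    using assms(3,4) by (auto simp: S T has_sides_def defs norm_minus_commute)
  have im: "Im p > 0" "Im p' > 0"
    using assms(1,2) by (simp_all add: S T triangles_def anticlockwise_def p_def p'_def defs)
  then have nz: "u \<noteq> 0" "u' \<noteq> 0" by (auto simp: p_def p'_def)
  have polar: "2 * Re (x * cnj y) = (cmod x)\<^sup>2 + (cmod y)\<^sup>2 - (cmod (x - y))\<^sup>2" for x y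
    by (simp only: cmod_power2 complex_cnj minus_complex.simps times_complex.simps cnj.simps)
       (simp add: power2_eq_square algebra_simps)
  have re: "Re p = Re p'"
    using polar[of v u] polar[of v' u'] sides by (simp add: p_def p'_def)
  have "cmod p = cmod p'"
    using sides by (simp add: p_def p'_def norm_mult)
  then have "(Im p)\<^sup>2 = (Im p')\<^sup>2"
    using re cmod_power2[of p] cmod_power2[of p'] by simp
  then have "Im p = Im p'"
    using im by (simp add: power2_eq_iff_nonneg)
  with re have pp: "p = p'" by (rule complex_eqI)
  have c2: "u * cnj u = of_real (c\<^sup>2)" "u' * cnj u' = of_real (c\<^sup>2)"
    using complex_norm_square[of u] complex_norm_square[of u'] sides by simp_all
  have "c \<noteq> 0" using nz(1) sides(1) by auto
  have "(u' * v) * (u * cnj u) = u * u' * p" by (simp add: p_def)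
  also have "\<dots> = (u * v') * (u' * cnj u')" by (simp add: pp p'_def)
  finally have "u' * v = u * v'" using c2 \<open>c \<noteq> 0\<close> by simp
  then have v': "v' = (u' / u) * v" using nz by (simp add: field_simps)
  let ?a = "u' / u"
  have "A' = ?a * A + (A' - ?a * A)" by simp
  moreover have "B' = ?a * B + (A' - ?a * A)"
  proof -
    have "?a * B + (A' - ?a * A) = ?a * u + A'" unfolding u_def by (simp only: right_diff_distrib) simp
    also have "\<dots> = B'" using nz by (simp add: u'_def)
    finally show ?thesis ..
  qed
  moreover have "C' = ?a * C + (A' - ?a * A)"
  proof -
    have "?a * C + (A' - ?a * A) = ?a * v + A'" unfolding v_def by (simp only: right_diff_distrib) simp
    also have "\<dots> = C'" using v' by (simp add: v'_def diff_eq_eq)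
    finally show ?thesis ..
  qed
  moreover have "?a \<noteq> 0" using nz by simp
  ultimately show ?thesis
    using assms(1,2) unfolding S T similarity_iff by blast
qed

end

theory Submission
  imports Defs
begin

text \<open>With \<open>\<omega> = \<rho>\<^sup>2\<close>, the triple \<open>(A, B, C)\<close> is determined by its discrete Fourier transform
  \<open>S = A + B + C\<close>, \<open>N = A + \<omega> B + \<omega>\<^sup>2 C\<close>, \<open>D = A + \<omega>\<^sup>2 B + \<omega> C\<close>. A map \<open>z \<mapsto> a z + b\<close> scales both \<open>N\<close> and
  \<open>D\<close> by \<open>a\<close> and moves \<open>S\<close> arbitrarily, and \<open>\<bar>D\<bar>\<^sup>2 - \<bar>N\<bar>\<^sup>2\<close> is a positive multiple of the signed area;
  hence \<open>N / D\<close> is a bijection from the similarity classes onto the disk. The triangle with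
  \<open>S = 0\<close>, \<open>D = \<surd>3\<close>, \<open>N = \<surd>3 q\<close> has side lengths \<open>\<bar>q - 1\<bar>\<close>, \<open>\<bar>q - \<omega>\<^sup>2\<bar>\<close>, \<open>\<bar>q - \<omega>\<bar>\<close>; for \<open>q = \<i> cnj P\<close>
  these are the distances from \<open>P\<close> to \<open>A\<^sub>0 = \<i>\<close>, \<open>B\<^sub>0 = \<i> \<omega>\<close>, \<open>C\<^sub>0 = \<i> \<omega>\<^sup>2\<close>, which proves Pompeiu's
  theorem and the formula at once.\<close>

definition omega :: complex where
  "omega = Complex (- 1 / 2) (sqrt 3 / 2)"

text \<open>The coefficient \<open>- 1 - omega\<close> is the square of \<open>omega\<close>,
  written so that every expression stays linear in \<open>omega\<close>.\<close>

definition dft1 :: "vertices \<Rightarrow> complex" where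
  "dft1 = (\<lambda>(A, B, C). A + omega * B + (- 1 - omega) * C)"

definition dft2 :: "vertices \<Rightarrow> complex" where
  "dft2 = (\<lambda>(A, B, C). A + (- 1 - omega) * B + omega * C)"

text \<open>The inverse transform of the prescribed data. As the differences of the cube roots of
  unity have modulus \<open>sqrt 3\<close>, this scale makes the sides equal to distances, not
  merely proportional to them.\<close>

definition disk_triangle :: "complex \<Rightarrow> vertices" where
  "disk_triangle q =
    ((q + 1) / sqrt 3, ((- 1 - omega) * q + omega) / sqrt 3, (omega * q - 1 - omega) / sqrt 3)"

lemma omega_times_omega: "omega * omega = - 1 - omega"
  by (simp add: omega_def complex_eq_iff)

lemma omega_times_omega_left: "omega * (omega * z) = - z - omega * z"
  by (simp add: omega_times_omega algebra_simps flip: mult.assoc)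

lemma rho_power2: "rho ^ 2 = omega"
proof -
  have "rho ^ 2 = cis (2 * pi / 3)"
    unfolding rho_def by (simp add: cis_conv_exp mult_ac flip: exp_of_nat_mult)
  then show ?thesis
    by (simp add: omega_def complex_eq_iff cos_120 sin_120)
qed

lemma rho_power4: "rho ^ 4 = - 1 - omega"
  using rho_sum rho_power2 by (simp add: algebra_simps eq_neg_iff_add_eq_0)

lemma vertex_quotient_eq: "vertex_quotient T = dft1 T / dft2 T"
  by (simp add: vertex_quotient_def dft1_def dft2_def rho_power2 rho_power4 split: prod.split)

lemma norm_dft_diff:
  "(cmod (dft2 (A, B, C)))\<^sup>2 - (cmod (dft1 (A, B, C)))\<^sup>2 = 2 * sqrt 3 * Im ((C - A) * cnj (B - A))"
  by (simp only: cmod_power2 dft1_def dft2_def)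
     (simp add: omega_def power2_eq_square algebra_simps)

text \<open>\<open>norm_dft_diff\<close> turns positivity of the signed area into this
  comparison.\<close>

lemma triangles_iff: "T \<in> triangles \<longleftrightarrow> cmod (dft1 T) < cmod (dft2 T)"
proof -
  obtain A B C where T: "T = (A, B, C)" by (metis prod_cases3)
  have "T \<in> triangles \<longleftrightarrow> 0 < Im ((C - A) * cnj (B - A))"
    unfolding T triangles_def
    using anticlockwise_imp_not_collinear[of A B C] by (auto simp: anticlockwise_def)
  also have "\<dots> \<longleftrightarrow> (cmod (dft1 T))\<^sup>2 < (cmod (dft2 T))\<^sup>2"
  proof -
    have "0 < x \<longleftrightarrow> 0 < 2 * sqrt 3 * x" for x by (simp add: zero_less_mult_iff)
    then show ?thesis unfolding T by (metis norm_dft_diff diff_gt_0_iff_gt)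
  qed
  also have "\<dots> \<longleftrightarrow> cmod (dft1 T) < cmod (dft2 T)"
    by (meson norm_ge_zero pos2 power_less_imp_less_base power_strict_mono)
  finally show ?thesis .
qed

lemma dft2_nonzero: "T \<in> triangles \<Longrightarrow> dft2 T \<noteq> 0"
  by (auto simp: triangles_iff)

lemma vertex_quotient_in_disk:
  assumes "T \<in> triangles"
  shows "vertex_quotient T \<in> unit_disk"
  using assms dft2_nonzero[OF assms]
  by (simp add: vertex_quotient_eq unit_disk_def triangles_iff norm_divide)

lemma dft_inversion:
  "3 * A = (A + B + C) + dft1 (A, B, C) + dft2 (A, B, C)"
  "3 * B = (A + B + C) + (- 1 - omega) * dft1 (A, B, C) + omega * dft2 (A, B, C)"
  "3 * C = (A + B + C) + omega * dft1 (A, B, C) + (- 1 - omega) * dft2 (A, B, C)"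
  by (simp_all add: dft1_def dft2_def algebra_simps omega_times_omega omega_times_omega_left)

text \<open>Equal quotients mean that one factor \<open>a\<close> scales both \<open>dft1\<close>
  and \<open>dft2\<close>; a translation then matches the vertex sums, and
  \<open>dft_inversion\<close> recovers the vertices.\<close>

lemma similar_if_vertex_quotient_eq:
  assumes "S \<in> triangles" "T \<in> triangles" "vertex_quotient S = vertex_quotient T"
  shows "(S, T) \<in> similarity"
proof -
  obtain A B C A' B' C' where S: "S = (A, B, C)" and T: "T = (A', B', C')"
    by (metis prod_cases3)
  define a where "a = dft2 T / dft2 S"
  \<comment> \<open>The translation that carries \<open>a\<close> times the centroid of
    \<open>S\<close> to the centroid of \<open>T\<close>.\<close>
  define b where "b = ((A' + B' + C') - a * (A + B + C)) / 3"
  have nz: "dft2 S \<noteq> 0" "dft2 T \<noteq> 0"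
    using assms dft2_nonzero by auto
  have 2: "dft2 T = a * dft2 S" using nz by (simp add: a_def)
  have 1: "dft1 T = a * dft1 S"
    using assms(3) nz by (simp add: vertex_quotient_eq a_def field_simps)
  have 0: "A' + B' + C' = a * (A + B + C) + 3 * b" by (simp add: b_def field_simps)
  note 012 = 0 1[unfolded S T] 2[unfolded S T]
  have cancel_3: "x = y" if "3 * x = 3 * y" for x y :: complex using that by simp
  have "A' = a * A + b"
    by (rule cancel_3) (use dft_inversion(1)[of A' B' C'] dft_inversion(1)[of A B C] 012 in algebra)
  \<comment> \<open>The instantiations follow the order in which the variables first occur in the
    formula, so \<open>B\<close> comes first here and \<open>C\<close> below.\<close>
  moreover have "B' = a * B + b"
    by (rule cancel_3) (use dft_inversion(2)[of B' A' C'] dft_inversion(2)[of B A C] 012 in algebra)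
  moreover have "C' = a * C + b"
    by (rule cancel_3) (use dft_inversion(3)[of C' A' B'] dft_inversion(3)[of C A B] 012 in algebra)
  moreover have "a \<noteq> 0" using nz by (simp add: a_def)
  ultimately show ?thesis
    using assms(1,2) unfolding S T similarity_iff by blast
qed

lemma dft_disk_triangle: "dft1 (disk_triangle q) = of_real (sqrt 3) * q" "dft2 (disk_triangle q) = sqrt 3"
proof -
  have r: "complex_of_real (sqrt 3) * sqrt 3 = 3"
    by (metis abs_numeral of_real_mult of_real_numeral real_sqrt_mult_self)
  show "dft1 (disk_triangle q) = of_real (sqrt 3) * q" "dft2 (disk_triangle q) = sqrt 3"
    using r
    by (simp_all add: disk_triangle_def dft1_def dft2_def field_simps
        omega_times_omega omega_times_omega_left)
qed

lemma disk_triangle_in_triangles: "q \<in> unit_disk \<Longrightarrow> disk_triangle q \<in> triangles"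
  by (simp add: triangles_iff dft_disk_triangle unit_disk_def norm_mult)

lemma vertex_quotient_disk_triangle: "vertex_quotient (disk_triangle q) = q"
  by (simp add: vertex_quotient_eq dft_disk_triangle)

lemma A0_eq: "A0 = Complex 0 1"
  by (simp add: A0_def complex_eq_iff)

lemma B0_eq: "B0 = Complex (- sqrt 3 / 2) (- 1 / 2)"
proof -
  have "B0 = - cis (pi / 6)" by (simp add: B0_def cis_conv_exp mult_ac)
  then show ?thesis by (simp add: complex_eq_iff cos_30 sin_30)
qed

lemma C0_eq: "C0 = Complex (sqrt 3 / 2) (- 1 / 2)"
proof -
  have "C0 = cis (- (pi / 6))" by (simp add: C0_def cis_conv_exp mult_ac)
  then show ?thesis by (simp add: complex_eq_iff cos_30 sin_30)
qed

text \<open>The isometry \<open>z \<mapsto> \<i> * cnj z\<close> sends \<open>A0\<close>,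
  \<open>B0\<close>, \<open>C0\<close> to the cube roots of unity 1, \<open>omega\<^sup>2\<close>,
  \<open>omega\<close>, so distances from \<open>P\<close> become distances from
  \<open>\<i> * cnj P\<close> to these.\<close>

lemma has_sides_disk_triangle:
  "has_sides (cmod (P - A0)) (cmod (P - B0)) (cmod (P - C0)) (disk_triangle (\<i> * cnj P))"
proof -
  \<comment> \<open>Squaring removes the roots of the norms and leaves polynomial identities in the
    coordinates.\<close>
  have norm_eq: "cmod (x / sqrt 3 - y / sqrt 3) = cmod z" if "(cmod (x - y))\<^sup>2 = 3 * (cmod z)\<^sup>2" for x y z
  proof -
    have "cmod (x - y) = sqrt 3 * cmod z"
      using that by (metis norm_ge_zero real_sqrt_mult real_sqrt_unique)
    then show ?thesis by (simp add: norm_divide flip: diff_divide_distrib)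
  qed
  show ?thesis
    unfolding has_sides_def disk_triangle_def prod.case
    by (intro conjI norm_eq; simp only: cmod_power2)
       (simp_all add: A0_eq B0_eq C0_eq omega_def power2_eq_square algebra_simps)
qed

text \<open>The explicit disk triangle shows that the choice is possible; the chosen triangle has
  the same sides, hence is similar to it and shares its quotient.\<close>

lemma triangle_with_sides_pompeiu:
  fixes P defines "T \<equiv> triangle_with_sides (cmod (P - A0)) (cmod (P - B0)) (cmod (P - C0))"
  assumes "P \<in> unit_disk"
  shows "T \<in> triangles" "vertex_quotient T = \<i> * cnj P"
proof -
  have q: "\<i> * cnj P \<in> unit_disk" using assms(2) by (simp add: unit_disk_def norm_mult)
  have "T \<in> triangles \<and> has_sides (cmod (P - A0)) (cmod (P - B0)) (cmod (P - C0)) T"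
    unfolding T_def triangle_with_sides_def
    by (rule someI) (use disk_triangle_in_triangles[OF q] has_sides_disk_triangle in blast)
  then show "T \<in> triangles" and "vertex_quotient T = \<i> * cnj P"
    using same_sides_similar[OF disk_triangle_in_triangles[OF q] _ has_sides_disk_triangle]
      vertex_quotient_cong vertex_quotient_disk_triangle by (blast, metis)
qed

lemma phi_sim_class_eq: "T \<in> triangles \<Longrightarrow> phi (sim_class T) = vertex_quotient T"
  by (cases T) (simp add: phi_sim_class vertex_quotient_def)

lemma sim_class_in_sim_classes: "T \<in> triangles \<Longrightarrow> sim_class T \<in> sim_classes"
  by (simp add: sim_classes_def sim_class_def quotientI)

lemma sim_classes_cases:
  assumes "X \<in> sim_classes"
  obtains T where "T \<in> triangles" "X = sim_class T"
  using assms by (auto simp: sim_classes_def sim_class_def elim: quotientE)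

lemma bij_betw_phi: "bij_betw phi sim_classes unit_disk"
proof (rule bij_betw_imageI)
  show "inj_on phi sim_classes"
  proof (rule inj_onI)
    fix X Y assume "X \<in> sim_classes" "Y \<in> sim_classes" and eq: "phi X = phi Y"
    then obtain S T where "S \<in> triangles" "X = sim_class S" "T \<in> triangles" "Y = sim_class T"
      by (metis sim_classes_cases)
    with eq have "(S, T) \<in> similarity"
      by (simp add: similar_if_vertex_quotient_eq phi_sim_class_eq)
    then show "X = Y"
      unfolding \<open>X = _\<close> \<open>Y = _\<close> sim_class_def by (rule equiv_class_eq[OF equiv_similarity])
  qed
  show "phi ` sim_classes = unit_disk"
  proof
    show "phi ` sim_classes \<subseteq> unit_disk"
      by (auto elim!: sim_classes_cases simp: phi_sim_class_eq vertex_quotient_in_disk)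
    show "unit_disk \<subseteq> phi ` sim_classes"
    proof
      fix q assume "q \<in> unit_disk"
      then have T: "disk_triangle q \<in> triangles" by (rule disk_triangle_in_triangles)
      then have "q = phi (sim_class (disk_triangle q))"
        by (simp add: phi_sim_class_eq vertex_quotient_disk_triangle)
      with sim_class_in_sim_classes[OF T] show "q \<in> phi ` sim_classes" by blast
    qed
  qed
qed

lemma pompeiu_class_in_sim_classes: "P \<in> unit_disk \<Longrightarrow> pompeiu_class P \<in> sim_classes"
  by (simp add: pompeiu_class_def sim_class_in_sim_classes triangle_with_sides_pompeiu)

lemma phi_pompeiu_class: "P \<in> unit_disk \<Longrightarrow> phi (pompeiu_class P) = \<i> * cnj P"
  by (simp add: pompeiu_class_def phi_sim_class_eq triangle_with_sides_pompeiu)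

text \<open>The map is a reflection, hence its own inverse.\<close>

lemma bij_betw_i_cnj: "bij_betw (\<lambda>z. \<i> * cnj z) unit_disk unit_disk"
  by (rule bij_betw_byWitness[where f' = "\<lambda>z. \<i> * cnj z"])
     (auto simp: unit_disk_def norm_mult)

text \<open>Bijectivity is cancelled from the left: both \<open>phi\<close> and its composition with
  \<open>pompeiu_class\<close> are bijections.\<close>

lemma bij_betw_pompeiu_class: "bij_betw pompeiu_class unit_disk sim_classes"
proof -
  have "bij_betw (phi \<circ> pompeiu_class) unit_disk unit_disk"
    using bij_betw_i_cnj bij_betw_cong[of unit_disk "phi \<circ> pompeiu_class" "\<lambda>z. \<i> * cnj z"]
    by (simp add: phi_pompeiu_class)
  moreover have "pompeiu_class ` unit_disk \<subseteq> sim_classes"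
    using pompeiu_class_in_sim_classes by (rule image_subsetI)
  ultimately show ?thesis
    by (simp only: bij_betw_comp_iff2[OF bij_betw_phi])
qed

theorem theorem7:
  "bij_betw phi sim_classes unit_disk \<and>
   bij_betw phi_P sim_classes unit_disk \<and>
   (\<forall>P\<in>unit_disk. inv_into sim_classes phi_P P =
      sim_class (triangle_with_sides (cmod (P - A0)) (cmod (P - B0)) (cmod (P - C0)))) \<and>
   (\<forall>z\<in>unit_disk. (phi \<circ> inv_into sim_classes phi_P) z = \<i> * cnj z)"
proof -
  have bij: "bij_betw phi_P sim_classes unit_disk"
    unfolding phi_P_def by (rule bij_betw_the_inv_into[OF bij_betw_pompeiu_class])
  \<comment> \<open>\<open>phi_P\<close> is itself defined as an inverse, so inverting it again
    returns \<open>pompeiu_class\<close> on the disk.\<close>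
  have inv: "inv_into sim_classes phi_P P = pompeiu_class P" if "P \<in> unit_disk" for P
  proof (rule inv_into_f_eq)
    show "inj_on phi_P sim_classes" using bij by (rule bij_betw_imp_inj_on)
    show "pompeiu_class P \<in> sim_classes" using that by (rule pompeiu_class_in_sim_classes)
    show "phi_P (pompeiu_class P) = P"
      unfolding phi_P_def using bij_betw_imp_inj_on[OF bij_betw_pompeiu_class] that
      by (rule the_inv_into_f_f)
  qed
  show ?thesis
    using bij_betw_phi bij inv phi_pompeiu_class by (simp add: pompeiu_class_def)
qed

end
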